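(* Let $C$ be any bivariate copula with $\mu_\infty(C)=m$. Then $\beta(C)\in[g(m),h(m)]$, where \[ g(m)=\begin{cases}-1, & 0\leqslant m\leqslant\frac14,\\ 8m-3, & \frac14\leqslant m\leqslant\frac13,\end{cases} \qquad h(m)=\begin{cases}1, & 0\leqslant m\leqslant\frac16,\\ 3-12m, & \frac16\leqslant m\leqslant\frac14,\\ 1-4m, & \frac14\leqslant m\leqslant\frac13,\end{cases} \] and the bounds are attained (for each $m\in[0,\frac13]$, each of the two bounds is attained by some copula $C$ with $\mu_\infty(C)=m$). In particular, if $C$ is symmetric (i.e. $C(u,v)=C(v,u)$ for all $u,v$), then $\beta(C)$ can take any value in $[-1,1]$; and if $C$ takes the maximal possible asymmetry $\mu_\infty(C)=\frac13$, then $\beta(C)=-\frac13$.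
   Context: For a bivariate copula $C$, the measure of asymmetry is $\mu_\infty(C)=\max_{u,v\in[0,1]}|C(u,v)-C(v,u)|$; its range over all copulas is $[0,\frac13]$. Blomqvist's beta is $\beta(C)=4\,C\left(\frac12,\frac12\right)-1$. *)

theory Defs
  imports "HOL-Analysis.Analysis"
begin

text \<open>Bivariate copulas are represented by total functions on the plane; all definitions only look
  at their values on the unit square.\<close>

definition copula :: "(real \<Rightarrow> real \<Rightarrow> real) \<Rightarrow> bool" where
  "copula C \<longleftrightarrow>
     (\<forall>u\<in>{0..1}. \<forall>v\<in>{0..1}. C u v \<in> {0..1}) \<and>
     (\<forall>u\<in>{0..1}. C u 0 = 0 \<and> C 0 u = 0) \<and>
     (\<forall>u\<in>{0..1}. C u 1 = u \<and> C 1 u = u) \<and>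
     (\<forall>u\<in>{0..1}. \<forall>u'\<in>{0..1}. \<forall>v\<in>{0..1}. \<forall>v'\<in>{0..1}.
        u \<le> u' \<longrightarrow> v \<le> v' \<longrightarrow> 0 \<le> C u' v' - C u' v - C u v' + C u v)"

definition symmetric_copula :: "(real \<Rightarrow> real \<Rightarrow> real) \<Rightarrow> bool" where
  "symmetric_copula C \<longleftrightarrow> copula C \<and> (\<forall>u\<in>{0..1}. \<forall>v\<in>{0..1}. C u v = C v u)"

text \<open>For a copula this supremum is a maximum, see \<open>mu_infinity_attained\<close> below.\<close>

definition mu_infinity :: "(real \<Rightarrow> real \<Rightarrow> real) \<Rightarrow> real" where
  "mu_infinity C = (SUP p\<in>{0..1} \<times> {0..1}. \<bar>C (fst p) (snd p) - C (snd p) (fst p)\<bar>)"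

definition blomqvist_beta :: "(real \<Rightarrow> real \<Rightarrow> real) \<Rightarrow> real" where
  "blomqvist_beta C = 4 * C (1/2) (1/2) - 1"

text \<open>The two bounds are only meaningful for \<open>0 \<le> m \<le> 1/3\<close>, the range of \<open>mu_infinity\<close> on
  copulas. The values of neighbouring branches agree at the breakpoints.\<close>

definition beta_lower :: "real \<Rightarrow> real" where
  "beta_lower m = (if m \<le> 1/4 then -1 else 8 * m - 3)"

definition beta_upper :: "real \<Rightarrow> real" where
  "beta_upper m = (if m \<le> 1/6 then 1 else if m \<le> 1/4 then 3 - 12 * m else 1 - 4 * m)"

lemma copula_rectangle:
  assumes "copula C" "u \<in> {0..1}" "u' \<in> {0..1}" "v \<in> {0..1}" "v' \<in> {0..1}" "u \<le> u'" "v \<le> v'"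
  shows "0 \<le> C u' v' - C u' v - C u v' + C u v"
  using assms unfolding copula_def by blast

lemma copula_margins:
  assumes "copula C" "u \<in> {0..1}"
  shows "C u 0 = 0" "C 0 u = 0" "C u 1 = u" "C 1 u = u"
  using assms unfolding copula_def by blast+

lemma copula_lipschitz_fst:
  assumes C: "copula C" and "u \<in> {0..1}" "u' \<in> {0..1}" "v \<in> {0..1}"
  shows "\<bar>C u v - C u' v\<bar> \<le> \<bar>u - u'\<bar>"
proof -
  have *: "0 \<le> C b v - C a v \<and> C b v - C a v \<le> b - a"
    if ab: "a \<in> {0..1}" "b \<in> {0..1}" "a \<le> b" for a b
  proof -
    have "0 \<le> C b v - C b 0 - C a v + C a 0"
      by (rule copula_rectangle[OF C ab(1,2) _ _ ab(3)]) (use assms(4) in simp_all)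
    moreover have "0 \<le> C b 1 - C b v - C a 1 + C a v"
      by (rule copula_rectangle[OF C ab(1,2) _ _ ab(3)]) (use assms(4) in simp_all)
    ultimately show ?thesis
      using copula_margins[OF C ab(1)] copula_margins[OF C ab(2)] by linarith
  qed
  show ?thesis
  proof (cases "u \<le> u'")
    case True
    then show ?thesis using *[OF assms(2,3)] by linarith
  next
    case False
    then show ?thesis using *[OF assms(3,2)] by linarith
  qed
qed

lemma copula_swap:
  assumes C: "copula C"
  shows "copula (\<lambda>u v. C v u)"
proof -
  have "0 \<le> C v' u' - C v u' - C v' u + C v u"
    if "u \<in> {0..1}" "u' \<in> {0..1}" "v \<in> {0..1}" "v' \<in> {0..1}" "u \<le> u'" "v \<le> v'" for u u' v v'
    using copula_rectangle[OF C that(3,4,1,2,6,5)] by linarith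
  moreover have "C v u \<in> {0..1}" if "u \<in> {0..1}" "v \<in> {0..1}" for u v
    using C that unfolding copula_def by blast
  ultimately show ?thesis unfolding copula_def using copula_margins[OF C] by simp
qed

lemma copula_lipschitz:
  assumes "copula C" "u \<in> {0..1}" "u' \<in> {0..1}" "v \<in> {0..1}" "v' \<in> {0..1}"
  shows "\<bar>C u v - C u' v'\<bar> \<le> \<bar>u - u'\<bar> + \<bar>v - v'\<bar>"
  using copula_lipschitz_fst[OF assms(1-4)]
    copula_lipschitz_fst[OF copula_swap[OF assms(1)] assms(4,5,3)]
  by linarith

lemma copula_continuous_on:
  assumes "copula C"
  shows "continuous_on ({0..1} \<times> {0..1}) (\<lambda>p. C (fst p) (snd p))"
proof (rule continuous_onI)
  fix x :: "real \<times> real" and e :: real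
  assume x: "x \<in> {0..1} \<times> {0..1}" and e: "0 < e"
  have "dist (C (fst y) (snd y)) (C (fst x) (snd x)) \<le> e"
    if y: "y \<in> {0..1} \<times> {0..1}" "dist y x < e / 2" for y
  proof -
    have "\<bar>C (fst y) (snd y) - C (fst x) (snd x)\<bar> \<le> \<bar>fst y - fst x\<bar> + \<bar>snd y - snd x\<bar>"
      using x y(1) by (intro copula_lipschitz[OF assms]) auto
    moreover have "\<bar>fst y - fst x\<bar> \<le> dist y x" "\<bar>snd y - snd x\<bar> \<le> dist y x"
      using dist_fst_le[of y x] dist_snd_le[of y x] by (auto simp: dist_real_def)
    ultimately show ?thesis using y(2) by (simp add: dist_real_def)
  qed
  then show "\<exists>d>0. \<forall>x'\<in>{0..1} \<times> {0..1}. dist x' x < d \<longrightarrow>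
      dist (C (fst x') (snd x')) (C (fst x) (snd x)) \<le> e"
    using e by (intro exI[of _ "e/2"]) auto
qed

lemma mu_infinity_attained:
  assumes "copula C"
  shows "\<exists>u\<in>{0..1}. \<exists>v\<in>{0..1}. mu_infinity C = \<bar>C u v - C v u\<bar> \<and>
    (\<forall>u'\<in>{0..1}. \<forall>v'\<in>{0..1}. \<bar>C u' v' - C v' u'\<bar> \<le> \<bar>C u v - C v u\<bar>)"
proof -
  let ?S = "{0..1::real} \<times> {0..1::real}"
  let ?f = "\<lambda>p. \<bar>C (fst p) (snd p) - C (snd p) (fst p)\<bar>"
  have "continuous_on ?S ?f"
    using copula_continuous_on[OF assms] copula_continuous_on[OF copula_swap[OF assms]]
    by (intro continuous_intros) auto
  moreover have "compact ?S" by (intro compact_Times compact_Icc)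
  moreover have "?S \<noteq> {}" by auto
  ultimately obtain p where p: "p \<in> ?S" "\<And>q. q \<in> ?S \<Longrightarrow> ?f q \<le> ?f p"
    using continuous_attains_sup[of ?S ?f] by auto
  have "mu_infinity C = ?f p"
    unfolding mu_infinity_def using p by (intro cSup_eq_maximum) auto
  moreover have "\<bar>C u' v' - C v' u'\<bar> \<le> ?f p" if "u' \<in> {0..1}" "v' \<in> {0..1}" for u' v'
    using p(2)[of "(u', v')"] that by auto
  ultimately show ?thesis using p(1) by (intro bexI[of _ "fst p"] bexI[of _ "snd p"]) auto
qed

end

theory Submission
  imports Defs
begin

text \<open>
  If the asymmetry \<open>m\<close> is attained at \<open>a < b\<close>, say \<open>C a b = d + m\<close> and \<open>C b a = d\<close>, then
  \<open>m\<close> is at most \<open>a\<close>, \<open>1 - b\<close> and \<open>b - a\<close>, and the bounds on \<open>C (1/2) (1/2)\<close> follow from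
  monotonicity and the Lipschitz property, according to the position of \<open>1/2\<close> relative to \<open>a\<close>
  and \<open>b\<close>. The bounds are attained by the pointwise largest copulas with a zero prescribed at one
  point \<open>(p, q)\<close>, and by their flips.
\<close>

lemma copula_mono:
  assumes "copula C" "0 \<le> u" "u \<le> u'" "u' \<le> 1" "0 \<le> v" "v \<le> v'" "v' \<le> 1"
  shows "C u v \<le> C u' v'"
proof -
  have "0 \<le> C u' v - C u' 0 - C u v + C u 0" "0 \<le> C u' v' - C u' v - C 0 v' + C 0 v"
    using assms by (auto intro!: copula_rectangle)
  moreover have "C u' 0 = 0" "C u 0 = 0" "C 0 v' = 0" "C 0 v = 0"
    using assms by (auto simp: copula_margins)
  ultimately show ?thesis by linarith
qed

lemma copula_increment:
  assumes "copula C" "0 \<le> u" "u \<le> u'" "u' \<le> 1" "0 \<le> v" "v \<le> v'" "v' \<le> 1"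
  shows "C u' v' \<le> C u v + (u' - u) + (v' - v)"
  using copula_lipschitz[of C u' u v' v] assms by auto

lemma copula_frechet_hoeffding:
  assumes "copula C" "0 \<le> u" "u \<le> 1" "0 \<le> v" "v \<le> 1"
  shows "0 \<le> C u v" "u + v - 1 \<le> C u v" "C u v \<le> u" "C u v \<le> v"
  using copula_mono[OF assms(1), of u u v 1] copula_mono[OF assms(1), of u 1 v v]
    copula_mono[OF assms(1), of 0 u v v] copula_increment[OF assms(1), of u 1 v 1] assms
  by (auto simp: copula_margins)

text \<open>Equivalent to the bounds on beta via \<open>C (1/2) (1/2) = (beta + 1) / 4\<close>;
  \<open>max\<close> and \<open>min\<close> absorb the breakpoints.\<close>

lemma copula_mid_bounds:
  assumes C: "copula C" and ab: "0 \<le> a" "a < b" "b \<le> 1" and m: "C a b - C b a = m"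
  shows "max 0 (2 * m - 1/2) \<le> C (1/2) (1/2)"
    and "C (1/2) (1/2) \<le> min (1/2) (max (1 - 3 * m) (1/2 - m))"
proof -
  note bounds = copula_frechet_hoeffding[OF C, of "1/2" "1/2", simplified]
  note ba = copula_frechet_hoeffding[OF C, of b a]
  have d: "0 \<le> C b a" "a + b - 1 \<le> C b a" "C b a \<le> a - m"
    using ba copula_frechet_hoeffding[OF C, of a b] ab m by auto
  have ma: "m \<le> a" and mb: "m \<le> 1 - b" using d by linarith+
  \<comment> \<open>\<open>C a b\<close> exceeds \<open>C a a\<close> by at most
    \<open>b - a\<close>, and \<open>C a a\<close> is at most \<open>C b a\<close>.\<close>
  have mba: "m \<le> b - a"
    using copula_increment[OF C, of a a a b] copula_mono[OF C, of a b a a] ab m by simp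
  consider (low) "b \<le> 1/2" | (mid) "a \<le> 1/2" "1/2 \<le> b" | (high) "1/2 \<le> a" by linarith
  note pos = this
  \<comment> \<open>All cases start from \<open>C b a\<close> \<le> \<open>a - m\<close>. In
    \<open>mid\<close> this gives \<open>1/2 - m\<close>; in \<open>low\<close> and
    \<open>high\<close> the estimates \<open>m\<close> \<le> \<open>a\<close>, \<open>1 - b\<close>,
    \<open>b - a\<close> turn it into \<open>1 - 3 * m\<close> and force \<open>m\<close> \<le>
    \<open>1/4\<close>.\<close>
  from pos have upper: "C (1/2) (1/2) \<le> 1/2 - m \<or> m \<le> 1/4 \<and> C (1/2) (1/2) \<le> 1 - 3 * m"
  proof cases
    case low
    have "C (1/2) (1/2) \<le> C b a + (1/2 - b) + (1/2 - a)"
      using low ab by (intro copula_increment[OF C]) auto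
    then show ?thesis using low d ma mba by auto
  next
    case mid
    have "C (1/2) (1/2) \<le> C b (1/2)" using mid ab by (intro copula_mono[OF C]) auto
    also have "\<dots> \<le> C b a + (b - b) + (1/2 - a)"
      using mid ab by (intro copula_increment[OF C]) auto
    finally show ?thesis using d by auto
  next
    case high
    have "C (1/2) (1/2) \<le> C b a" using high ab by (intro copula_mono[OF C]) auto
    then show ?thesis using high d mb mba by auto
  qed
  from pos have "2 * m - 1/2 \<le> C (1/2) (1/2)"
  proof cases
    case mid
    have "C a b \<le> C a (1/2) + (a - a) + (b - 1/2)"
      using mid ab by (intro copula_increment[OF C]) auto
    moreover have "C a (1/2) \<le> C (1/2) (1/2)" using mid ab by (intro copula_mono[OF C]) auto
    ultimately show ?thesis using d m mb by auto
  \<comment> \<open>In \<open>low\<close> and \<open>high\<close>, \<open>2 * m\<close> \<le>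
    \<open>1/2\<close>, so nonnegativity of \<open>C\<close> suffices.\<close>
  qed (use bounds ma mb mba in auto)
  with upper bounds
  show "max 0 (2 * m - 1/2) \<le> C (1/2) (1/2)"
    "C (1/2) (1/2) \<le> min (1/2) (max (1 - 3 * m) (1/2 - m))"
    by auto
qed

lemma beta_lower_alt: "beta_lower m = 4 * max 0 (2 * m - 1/2) - 1"
  by (auto simp: beta_lower_def max_def)

lemma beta_upper_alt: "beta_upper m = 4 * min (1/2) (max (1 - 3 * m) (1/2 - m)) - 1"
  if "0 \<le> m"
  using that by (auto simp: beta_upper_def max_def min_def)

lemma blomqvist_beta_bounds:
  assumes C: "copula C"
  shows "blomqvist_beta C \<in> {beta_lower (mu_infinity C)..beta_upper (mu_infinity C)}"
proof -
  obtain u v where uv: "u \<in> {0..1}" "v \<in> {0..1}" and mu: "mu_infinity C = \<bar>C u v - C v u\<bar>"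
    using mu_infinity_attained[OF C] by blast
  define m where "m = mu_infinity C"
  have nonneg: "0 \<le> m" using mu by (simp add: m_def)
  have "max 0 (2 * m - 1/2) \<le> C (1/2) (1/2) \<and>
    C (1/2) (1/2) \<le> min (1/2) (max (1 - 3 * m) (1/2 - m))"
  proof (cases "u = v")
    case True
    then have "m = 0" using mu by (simp add: m_def)
    then show ?thesis using copula_frechet_hoeffding[OF C, of "1/2" "1/2"] by auto
  next
    case False
    define a b where "a = min u v" and "b = max u v"
    have ab: "0 \<le> a" "a < b" "b \<le> 1" using uv False by (auto simp: a_def b_def)
    have "m = \<bar>C a b - C b a\<bar>"
      using mu by (auto simp: m_def a_def b_def min_def max_def)
    then consider "C a b - C b a = m" | "C b a - C a b = m" by linarith
    then show ?thesis
      \<comment> \<open>Transposing \<open>C\<close> reverses the sign of the difference and keeps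
        the value at the midpoint.\<close>
      using copula_mid_bounds[OF C ab] copula_mid_bounds[OF copula_swap[OF C] ab]
      by cases auto
  qed
  then show ?thesis
    unfolding blomqvist_beta_def m_def[symmetric] beta_lower_alt beta_upper_alt[OF nonneg] by auto
qed

text \<open>A one-sided estimate suffices, since exchanging \<open>x\<close> and \<open>y\<close>
  changes the sign.\<close>

lemma mu_infinity_eqI:
  assumes "u \<in> {0..1}" "v \<in> {0..1}" "\<bar>C u v - C v u\<bar> = m"
    and "\<And>x y. x \<in> {0..1} \<Longrightarrow> y \<in> {0..1} \<Longrightarrow> C x y - C y x \<le> m"
  shows "mu_infinity C = m"
  unfolding mu_infinity_def
proof (rule cSup_eq_maximum)
  show "m \<in> (\<lambda>p. \<bar>C (fst p) (snd p) - C (snd p) (fst p)\<bar>) ` ({0..1} \<times> {0..1})"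
    using assms(1-3) by (intro image_eqI[of _ _ "(u, v)"]) auto
next
  fix z assume "z \<in> (\<lambda>p. \<bar>C (fst p) (snd p) - C (snd p) (fst p)\<bar>) ` ({0..1} \<times> {0..1})"
  then obtain x y where "x \<in> {0..1}" "y \<in> {0..1}" "z = \<bar>C x y - C y x\<bar>" by auto
  then show "z \<le> m" using assms(4)[of x y] assms(4)[of y x] by linarith
qed

text \<open>If \<open>C\<close> is the distribution function of (U, V), this is that of (U, 1 - V).
  It negates beta and so turns large midpoint values into small ones.\<close>

lemma copula_flip:
  assumes C: "copula C"
  shows "copula (\<lambda>u v. u - C u (1 - v))"
proof -
  have "0 \<le> (u' - C u' (1 - v')) - (u' - C u' (1 - v)) - (u - C u (1 - v')) + (u - C u (1 - v))"
    if "u \<in> {0..1}" "u' \<in> {0..1}" "v \<in> {0..1}" "v' \<in> {0..1}" "u \<le> u'" "v \<le> v'" for u u' v v'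
    using copula_rectangle[OF C, of u u' "1 - v'" "1 - v"] that by simp
  moreover have "u - C u (1 - v) \<in> {0..1}" if "u \<in> {0..1}" "v \<in> {0..1}" for u v
    using copula_frechet_hoeffding[OF C, of u "1 - v"] that by auto
  ultimately show ?thesis unfolding copula_def using copula_margins[OF C] by simp
qed

text \<open>The upper Frechet-Hoeffding bound, capped by the growth that monotonicity and the
  Lipschitz property allow from a zero at \<open>(p, q)\<close>.\<close>

definition zero_copula :: "real \<Rightarrow> real \<Rightarrow> real \<Rightarrow> real \<Rightarrow> real" where
  "zero_copula p q u v = min (min u v) (max 0 (u - p) + max 0 (v - q))"

lemma zero_copula_le:
  "zero_copula p q u v \<le> u" "zero_copula p q u v \<le> v"
  "zero_copula p q u v \<le> max 0 (u - p) + max 0 (v - q)"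
  by (simp_all add: zero_copula_def)

text \<open>Lower bounds on a minimum require knowing which term attains it; after this split only
  linear arithmetic remains.\<close>

lemma zero_copula_cases:
  obtains "zero_copula p q u v = u" | "zero_copula p q u v = v"
  | "zero_copula p q u v = max 0 (u - p) + max 0 (v - q)"
proof -
  have "min (min x y) z = x \<or> min (min x y) z = y \<or> min (min x y) z = z" for x y z :: real
    by linarith
  then show ?thesis using that unfolding zero_copula_def by blast
qed

text \<open>Each choice of minimal terms at \<open>(u, v)\<close> and \<open>(u', v')\<close>
  suggests terms bounding the mixed corners; both summands of the cap are nondecreasing and
  1-Lipschitz.\<close>

lemma zero_copula_rectangle:
  assumes "u \<le> u'" "v \<le> v'"
  shows "zero_copula p q u' v + zero_copula p q u v' \<le> zero_copula p q u' v' + zero_copula p q u v"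
proof -
  note le = zero_copula_le[of p q u v'] zero_copula_le[of p q u' v]
  have "max 0 (u - p) \<le> max 0 (u' - p)" "max 0 (u' - p) - max 0 (u - p) \<le> u' - u"
    "max 0 (v - q) \<le> max 0 (v' - q)" "max 0 (v' - q) - max 0 (v - q) \<le> v' - v"
    using assms by auto
  then show ?thesis
    by (cases rule: zero_copula_cases[of p q u v]; cases rule: zero_copula_cases[of p q u' v'])
      (use le assms in linarith)+
qed

lemma copula_zero_copula:
  assumes "0 \<le> p" "0 \<le> q" "p + q \<le> 1"
  shows "copula (zero_copula p q)"
proof -
  have "0 \<le> zero_copula p q u' v' - zero_copula p q u' v - zero_copula p q u v' + zero_copula p q u v"
    if "u \<le> u'" "v \<le> v'" for u u' v v'
    using zero_copula_rectangle[OF that, of p q] by linarith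
  moreover have "zero_copula p q u v \<in> {0..1}" if "u \<in> {0..1}" "v \<in> {0..1}" for u v
    using that by (auto simp: zero_copula_def)
  moreover have "zero_copula p q u 0 = 0 \<and> zero_copula p q 0 u = 0" if "u \<in> {0..1}" for u
    using that assms by (auto simp: zero_copula_def)
  moreover have "zero_copula p q u 1 = u \<and> zero_copula p q 1 u = u" if "u \<in> {0..1}" for u
  proof -
    have "u \<le> max 0 (u - p) + max 0 (1 - q)" "u \<le> max 0 (1 - p) + max 0 (u - q)"
      using assms by linarith+
    then show ?thesis using that by (simp add: zero_copula_def)
  qed
  ultimately show ?thesis unfolding copula_def by blast
qed

text \<open>Only the cap is asymmetric, and \<open>x\<close> \<le>
  \<open>q + max 0 (x - q)\<close>.\<close>

lemma zero_copula_asymmetry_le: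
  assumes "0 \<le> q"
  shows "zero_copula p q x y - zero_copula p q y x \<le> q"
  by (cases rule: zero_copula_cases[of p q y x])
    (use zero_copula_le[of p q x y] assms in linarith)+

lemma flip_zero_copula_asymmetry_le:
  assumes "0 \<le> p"
  shows "(x - zero_copula p q x (1 - y)) - (y - zero_copula p q y (1 - x)) \<le> p"
  by (cases rule: zero_copula_cases[of p q x "1 - y"])
    (use zero_copula_le[of p q y "1 - x"] assms in linarith)+

lemma beta_upper_attained:
  assumes "0 \<le> m" "m \<le> 1/3"
  shows "\<exists>C. copula C \<and> mu_infinity C = m \<and> blomqvist_beta C = beta_upper m"
proof (intro exI conjI)
  \<comment> \<open>Taking \<open>a = m\<close>, \<open>b = 2 * m\<close> and
    \<open>C b a = 0\<close> makes \<open>m\<close> \<le> \<open>a\<close> and \<open>m\<close>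
    \<le> \<open>b - a\<close> equalities; the condition \<open>p + q\<close> \<le> \<open>1\<close>
    becomes \<open>m\<close> \<le> \<open>1/3\<close>.\<close>
  let ?C = "zero_copula (2 * m) m"
  show "copula ?C" using assms by (intro copula_zero_copula) auto
  have "?C m (2 * m) = m" "?C (2 * m) m = 0" using assms by (auto simp: zero_copula_def)
  then show "mu_infinity ?C = m"
    using assms zero_copula_asymmetry_le by (intro mu_infinity_eqI[of m "2 * m"]) auto
  have "?C (1/2) (1/2) = min (1/2) (max (1 - 3 * m) (1/2 - m))"
    using assms by (auto simp: zero_copula_def min_def max_def)
  then show "blomqvist_beta ?C = beta_upper m"
    using assms by (simp add: blomqvist_beta_def beta_upper_alt)
qed

lemma beta_lower_attained:
  assumes "0 \<le> m" "m \<le> 1/3"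
  shows "\<exists>C. copula C \<and> mu_infinity C = m \<and> blomqvist_beta C = beta_lower m"
proof (intro exI conjI)
  \<comment> \<open>Here \<open>a = m\<close>, \<open>b = 1 - m\<close>, with
    \<open>C a b = m\<close> and \<open>C b a = 0\<close>: equality in \<open>m\<close> \<le>
    \<open>a\<close> and \<open>m\<close> \<le> \<open>1 - b\<close>.\<close>
  let ?C = "\<lambda>u v. u - zero_copula m m u (1 - v)"
  show "copula ?C" using assms by (intro copula_flip copula_zero_copula) auto
  have "zero_copula m m m m = 0" "zero_copula m m (1 - m) (1 - m) = 1 - m"
    using assms by (auto simp: zero_copula_def)
  then show "mu_infinity ?C = m"
    using assms flip_zero_copula_asymmetry_le by (intro mu_infinity_eqI[of m "1 - m"]) auto
  have "?C (1/2) (1/2) = max 0 (2 * m - 1/2)"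
    using assms by (auto simp: zero_copula_def min_def max_def)
  then show "blomqvist_beta ?C = beta_lower m"
    by (simp add: blomqvist_beta_def beta_lower_alt)
qed

lemma symmetric_beta_attained:
  assumes "-1 \<le> b" "b \<le> 1"
  shows "\<exists>C. symmetric_copula C \<and> blomqvist_beta C = b"
proof (intro exI conjI)
  \<comment> \<open>Solves \<open>1 - 2 * t = (b + 1) / 4\<close>, the cap at the midpoint;
    \<open>t\<close> runs through [1/4, 1/2], where the cap is the minimal term.\<close>
  let ?t = "(3 - b) / 8"
  have "zero_copula ?t ?t u v = zero_copula ?t ?t v u" for u v
    by (simp only: zero_copula_def min.commute[of u v] add.commute)
  then show "symmetric_copula (zero_copula ?t ?t)"
    unfolding symmetric_copula_def using assms by (auto intro!: copula_zero_copula)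
  have "zero_copula ?t ?t (1/2) (1/2) = (b + 1) / 4"
    using assms by (auto simp: zero_copula_def min_def max_def field_simps)
  then show "blomqvist_beta (zero_copula ?t ?t) = b"
    by (simp add: blomqvist_beta_def)
qed

theorem theorem20:
  shows "(\<forall>C m. copula C \<and> mu_infinity C = m \<longrightarrow> blomqvist_beta C \<in> {beta_lower m..beta_upper m}) \<and>
    (\<forall>m\<in>{0..1/3}. \<exists>C. copula C \<and> mu_infinity C = m \<and> blomqvist_beta C = beta_lower m) \<and>
    (\<forall>m\<in>{0..1/3}. \<exists>C. copula C \<and> mu_infinity C = m \<and> blomqvist_beta C = beta_upper m) \<and>
    (\<forall>b\<in>{-1..1}. \<exists>C. symmetric_copula C \<and> blomqvist_beta C = b) \<and>
    (\<forall>C. copula C \<and> mu_infinity C = 1/3 \<longrightarrow> blomqvist_beta C = -1/3)"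
proof -
  \<comment> \<open>Both bounds equal \<open>-1/3\<close> at \<open>m = 1/3\<close>.\<close>
  have "blomqvist_beta C = -1/3" if "copula C" "mu_infinity C = 1/3" for C
    using blomqvist_beta_bounds[OF that(1)] that(2) by (simp add: beta_lower_def beta_upper_def)
  then show ?thesis
    using blomqvist_beta_bounds beta_lower_attained beta_upper_attained symmetric_beta_attained
    by auto
qed

end
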